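(* Let $\xi$ be a quantum environment, and suppose that for every two-player game of private information $\mathbf{G}$ (with strategy sets $S_1=S_2=\{\mathbf{H},\mathbf{T}\}$ and finite signal sets), the game $\mathbf{G}(\xi)^\#$ is a stochastic extension of the game $\mathbf{G}^\#$. Then $\xi$ is classical.
   Context: All games have two players; a game is given by strategy sets $S_1,S_2$ and payoff functions $P_1,P_2:S_1\times S_2\to\mathbb{R}$. **Game of private information.** It consists of strategy sets $S_1,S_2$, signal sets $\mathcal{A}_1,\mathcal{A}_2$, a probability distribution $\nu$ on $\mathcal{A}_1\times\mathcal{A}_2$, and payoff functions $P_i:\mathcal{A}_1\times\mathcal{A}_2\times S_1\times S_2\to\mathbb{R}$ ($i=1,2$). For a game of private information $\mathbf{G}$ as initially given, the strategy and signal sets are finite; games of private information constructed from it (such as $\mathbf{G}(\xi)$ below) may have infinite strategy sets. **Associated game $\mathbf{G}^\#$.** For a game of private information $\mathbf{G}$, the ordinary game $\mathbf{G}^\#$ has strategy sets $S_i^\#$ = the set of all functions $\mathcal{A}_i\to S_i$, and payoff functions $P_i^\#(F_1,F_2)=\int_{\mathcal{A}_1\times\mathcal{A}_2}P_i(A_1,A_2,F_1(A_1),F_2(A_2))\,d\nu(A_1,A_2)$. **Quantum environment.** Let $S_1=S_2=\{\mathbf{H},\mathbf{T}\}$. A quantum environment is a non-zero vector $\xi$ in the 4-dimensional complex vector space with basis $\mathbf{HH},\mathbf{HT},\mathbf{TH},\mathbf{TT}$, identified with $\mathbb{C}^2\otimes\mathbb{C}^2$, where $\mathbb{C}^2$ has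 basis $\mathbf{H},\mathbf{T}$ (and $\mathbf{HT}=\mathbf{H}\otimes\mathbf{T}$, etc.). Let $\mathcal{U}$ be the set of unitary transformations of $\mathbb{C}^2$, and let $\mathcal{U}_i=\mathcal{U}\cup S_i$ (elements of $S_i$ are called pure strategies). **Distribution $\mu_{UV}$.** For $(U,V)\in\mathcal{U}_1\times\mathcal{U}_2$ define a probability distribution $\mu_{UV}$ on $S_1\times S_2$: (a) If $U,V\in\mathcal{U}$, write $(U\otimes V)\xi=\alpha\mathbf{HH}+\beta\mathbf{HT}+\gamma\mathbf{TH}+\delta\mathbf{TT}$ ($U$ acts on the first factor, $V$ on the second). The probabilities of $(\mathbf{H},\mathbf{H}),(\mathbf{H},\mathbf{T}),(\mathbf{T},\mathbf{H}),(\mathbf{T},\mathbf{T})$ are proportional to $|\alpha|^2,|\beta|^2,|\gamma|^2,|\delta|^2$. (b) If $U\in\mathcal{U}$ and $V=s\in S_2$ is a pure strategy, write $(U\otimes I)\xi=\alpha\mathbf{HH}+\beta\mathbf{HT}+\gamma\mathbf{TH}+\delta\mathbf{TT}$, where $I$ is the identity transformation. Then $\mu_{U,s}(\mathbf{H},s)$ and $\mu_{U,s}(\mathbf{T},s)$ add to one and are proportional to the squared norms of the coefficients on $\mathbf{H}s$ and $\mathbf{T}s$ (that is, to $|\alpha|^2$ and $|\gamma|^2$ if $s=\mathbf{H}$, and to $|\beta|^2$ and $|\delta|^2$ if $s=\mathbf{T}$). (c) If $U=s\in S_1$ is a pure strategy and $V\in\mathcal{U}$, $\mu_{s,V}$ is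 defined analogously to (b), with the roles of the two factors exchanged. (d) If $U=s$ and $V=t$ are pure strategies, $\mu_{UV}$ is concentrated on $(s,t)$. **The game $\mathbf{G}(\xi)$.** For a game of private information $\mathbf{G}$ with $S_1=S_2=\{\mathbf{H},\mathbf{T}\}$, $\mathbf{G}(\xi)$ is the game of private information with the same signal sets and the same distribution $\nu$, with strategy sets $\mathcal{U}_1,\mathcal{U}_2$, and payoffs $P_i(A_1,A_2,U,V)=\int_{S_1\times S_2}P_i(A_1,A_2,s,t)\,d\mu_{UV}(s,t)$. The game $\mathbf{G}(\xi)^\#$ is the associated game of $\mathbf{G}(\xi)$; so a strategy of Player $i$ in it is a function $\mathcal{A}_i\to\mathcal{U}_i$. **Stochastic extension.** A game $\mathbf{K}'$ (strategy sets $S_i'$, payoffs $P_i'$) is a stochastic extension of a game $\mathbf{K}$ (strategy sets $S_i$, payoffs $P_i$) if for every $(s',t')\in S_1'\times S_2'$ there is a probability distribution $\mu$ on $S_1\times S_2$ such that $P_i'(s',t')=\int_{S_1\times S_2}P_i(s,t)\,d\mu(s,t)$ for $i=1,2$. **Classical quantum environment.** Let $\Omega=[0,1]$ be the unit interval, viewed as a probability space, and let $\mathcal{F}_i$ be the set of all $S_i$-valued random variables on $\Omega$. For $(F,G)\in\mathcal{F}_1\times\mathcal{F}_2$ let $\mu_{FG}$ be the probability distribution on $S_1\times S_2$ induced by $(F,G)$. The quantum environment $\xi$ is called classical if there are maps $\phi_i:\mathcal{U}_i\to\mathcal{F}_i$ ($i=1,2$) such that for every $(U,V)\in\mathcal{U}_1\times\mathcal{U}_2$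 the distributions $\mu_{UV}$ and $\mu_{\phi_1(U)\phi_2(V)}$ are identical. *)

theory Defs
  imports "HOL-Probability.Probability"
begin

record ('s1, 's2) game =
  strat1 :: "'s1 set"
  strat2 :: "'s2 set"
  payoff1 :: "'s1 \<Rightarrow> 's2 \<Rightarrow> real"
  payoff2 :: "'s1 \<Rightarrow> 's2 \<Rightarrow> real"

record ('a1, 'a2, 's1, 's2) private_game =
  pstrat1 :: "'s1 set"
  pstrat2 :: "'s2 set"
  signals1 :: "'a1 set"
  signals2 :: "'a2 set"
  signal_dist :: "('a1 \<times> 'a2) pmf"
  ppayoff1 :: "'a1 \<Rightarrow> 'a2 \<Rightarrow> 's1 \<Rightarrow> 's2 \<Rightarrow> real"
  ppayoff2 :: "'a1 \<Rightarrow> 'a2 \<Rightarrow> 's1 \<Rightarrow> 's2 \<Rightarrow> real"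

text \<open>The signal sets are finite throughout, so a probability distribution on their product is
  a \<^typ>\<open>('a1 \<times> 'a2) pmf\<close> supported there (in particular they are non-empty).\<close>

definition finite_signals :: "('a1, 'a2, 's1, 's2) private_game \<Rightarrow> bool" where
  "finite_signals G \<longleftrightarrow>
     finite (signals1 G) \<and> finite (signals2 G) \<and>
     set_pmf (signal_dist G) \<subseteq> signals1 G \<times> signals2 G"

definition associated_game ::
  "('a1, 'a2, 's1, 's2) private_game \<Rightarrow> ('a1 \<Rightarrow> 's1, 'a2 \<Rightarrow> 's2) game" where
  "associated_game G =
     \<lparr>strat1 = signals1 G \<rightarrow>\<^sub>E pstrat1 G,
      strat2 = signals2 G \<rightarrow>\<^sub>E pstrat2 G,
      payoff1 = (\<lambda>F1 F2. measure_pmf.expectation (signal_dist G)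
                   (\<lambda>(a, b). ppayoff1 G a b (F1 a) (F2 b))),
      payoff2 = (\<lambda>F1 F2. measure_pmf.expectation (signal_dist G)
                   (\<lambda>(a, b). ppayoff2 G a b (F1 a) (F2 b)))\<rparr>"

text \<open>\<open>stochastic_extension K' K\<close>: the game \<open>K'\<close> is a stochastic extension of \<open>K\<close>.
  Discrete distributions are all distributions when the strategy sets of \<open>K\<close> are finite,
  and integrability is then automatic.\<close>

definition stochastic_extension :: "('t1, 't2) game \<Rightarrow> ('s1, 's2) game \<Rightarrow> bool" where
  "stochastic_extension K' K \<longleftrightarrow>
     (\<forall>s'\<in>strat1 K'. \<forall>t'\<in>strat2 K'.
        \<exists>p :: ('s1 \<times> 's2) pmf.
          set_pmf p \<subseteq> strat1 K \<times> strat2 K \<and>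
          integrable (measure_pmf p) (\<lambda>(s, t). payoff1 K s t) \<and>
          integrable (measure_pmf p) (\<lambda>(s, t). payoff2 K s t) \<and>
          payoff1 K' s' t' = measure_pmf.expectation p (\<lambda>(s, t). payoff1 K s t) \<and>
          payoff2 K' s' t' = measure_pmf.expectation p (\<lambda>(s, t). payoff2 K s t))"

datatype coin = Heads | Tails

instance coin :: finite
proof
  have "(UNIV :: coin set) = {Heads, Tails}"
    using coin.exhaust by auto
  then show "finite (UNIV :: coin set)"
    by (metis finite.emptyI finite.insertI)
qed

text \<open>\<open>\<complex>\<^sup>2\<close> has coordinates indexed by \<^typ>\<open>coin\<close>, and \<open>\<complex>\<^sup>2 \<otimes> \<complex>\<^sup>2\<close> has coordinates
  indexed by \<^typ>\<open>coin \<times> coin\<close>; transformations are given by their matrices in the basis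
  \<open>H, T\<close>, respectively \<open>HH, HT, TH, TT\<close>.\<close>

definition adjoint_matrix :: "complex ^ 'n ^ 'm \<Rightarrow> complex ^ 'm ^ 'n" where
  "adjoint_matrix A = (\<chi> i j. cnj (A $ j $ i))"

definition unitary :: "complex ^ 'n ^ 'n \<Rightarrow> bool" where
  "unitary U \<longleftrightarrow> adjoint_matrix U ** U = mat 1 \<and> U ** adjoint_matrix U = mat 1"

definition tensor :: "complex ^ 'n ^ 'm \<Rightarrow> complex ^ 'l ^ 'k \<Rightarrow> complex ^ ('n \<times> 'l) ^ ('m \<times> 'k)"
  where "tensor U V = (\<chi> x y. U $ fst x $ fst y * V $ snd x $ snd y)"

datatype qstrategy = Unitary "complex ^ coin ^ coin" | Pure coin

definition qstrategies :: "qstrategy set" where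
  "qstrategies = Unitary ` {U. unitary U} \<union> range Pure"

definition proportional_on ::
  "(coin \<times> coin) set \<Rightarrow> (coin \<times> coin) pmf \<Rightarrow> complex ^ (coin \<times> coin) \<Rightarrow> bool" where
  "proportional_on A p v \<longleftrightarrow>
     set_pmf p \<subseteq> A \<and> (\<exists>c. \<forall>x\<in>A. (cmod (v $ x))\<^sup>2 = c * pmf p x)"

text \<open>\<open>outcome_dist \<xi> U V p\<close>: the distribution \<open>p\<close> satisfies the description of \<open>\<mu>\<^bsub>UV\<^esub>\<close>.
  When exactly one of \<open>U\<close>, \<open>V\<close> is pure, the two relevant coefficients may both vanish (for
  instance \<open>\<xi> = HH\<close> and \<open>V\<close> the pure strategy \<open>T\<close>). The description then does not determine
  a distribution, and every distribution on the two relevant outcomes satisfies it. In all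
  other cases, \<open>p\<close> is unique for \<open>\<xi> \<noteq> 0\<close> and unitary \<open>U\<close>, \<open>V\<close>.\<close>

fun outcome_dist ::
  "complex ^ (coin \<times> coin) \<Rightarrow> qstrategy \<Rightarrow> qstrategy \<Rightarrow> (coin \<times> coin) pmf \<Rightarrow> bool" where
  "outcome_dist \<xi> (Unitary U) (Unitary V) p \<longleftrightarrow> proportional_on UNIV p (tensor U V *v \<xi>)"
| "outcome_dist \<xi> (Unitary U) (Pure s) p \<longleftrightarrow>
     proportional_on (UNIV \<times> {s}) p (tensor U (mat 1) *v \<xi>)"
| "outcome_dist \<xi> (Pure s) (Unitary V) p \<longleftrightarrow>
     proportional_on ({s} \<times> UNIV) p (tensor (mat 1) V *v \<xi>)"
| "outcome_dist \<xi> (Pure s) (Pure t) p \<longleftrightarrow> p = return_pmf (s, t)"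

text \<open>\<open>\<mu>\<close> is a family of distributions \<open>\<mu>\<^bsub>UV\<^esub>\<close> as defined by \<open>\<xi>\<close>. It is uniquely determined on
  \<^const>\<open>qstrategies\<close> if no row and no column of coefficients of \<open>\<xi>\<close> vanishes; otherwise it
  also records the choice made in the undetermined cases. The notions below depend on the
  environment \<open>\<xi>\<close> only through \<open>\<mu>\<close>, so they take \<open>\<mu>\<close> as argument.\<close>

definition outcome_family ::
  "complex ^ (coin \<times> coin) \<Rightarrow> (qstrategy \<Rightarrow> qstrategy \<Rightarrow> (coin \<times> coin) pmf) \<Rightarrow> bool" where
  "outcome_family \<xi> \<mu> \<longleftrightarrow> (\<forall>U\<in>qstrategies. \<forall>V\<in>qstrategies. outcome_dist \<xi> U V (\<mu> U V))"

definition quantum_game ::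
  "(qstrategy \<Rightarrow> qstrategy \<Rightarrow> (coin \<times> coin) pmf) \<Rightarrow> ('a1, 'a2, coin, coin) private_game \<Rightarrow>
     ('a1, 'a2, qstrategy, qstrategy) private_game" where
  "quantum_game \<mu> G =
     \<lparr>pstrat1 = qstrategies,
      pstrat2 = qstrategies,
      signals1 = signals1 G,
      signals2 = signals2 G,
      signal_dist = signal_dist G,
      ppayoff1 = (\<lambda>a b U V. measure_pmf.expectation (\<mu> U V) (\<lambda>(s, t). ppayoff1 G a b s t)),
      ppayoff2 = (\<lambda>a b U V. measure_pmf.expectation (\<mu> U V) (\<lambda>(s, t). ppayoff2 G a b s t))\<rparr>"

definition unit_interval :: "real measure" where
  "unit_interval = restrict_space lborel {0..1}"

definition coin_variables :: "(real \<Rightarrow> coin) set" where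
  "coin_variables = unit_interval \<rightarrow>\<^sub>M count_space UNIV"

definition classical :: "(qstrategy \<Rightarrow> qstrategy \<Rightarrow> (coin \<times> coin) pmf) \<Rightarrow> bool" where
  "classical \<mu> \<longleftrightarrow>
     (\<exists>\<phi>1 \<in> qstrategies \<rightarrow> coin_variables. \<exists>\<phi>2 \<in> qstrategies \<rightarrow> coin_variables.
        \<forall>U\<in>qstrategies. \<forall>V\<in>qstrategies.
          measure_pmf (\<mu> U V) =
            distr unit_interval (count_space UNIV) (\<lambda>\<omega>. (\<phi>1 U \<omega>, \<phi>2 V \<omega>)))"

end

theory Submission
  imports Defs
begin

text \<open>Only games in which one player receives two equally likely signals and the other one signal are
  needed. Let the payoff be the indicator of an outcome of the uninformed player, with a sign given by
  the other player's signal. It averages to zero in the classical game, so in a stochastic extension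
  the marginal outcome distribution of a player does not depend on the opponent's strategy. For pure
  strategies of the opponent, this forces the two columns of the coefficient matrix of \<open>\<xi>\<close> to be
  linearly dependent, i.e. \<open>\<xi>\<close> is a product vector. Then every \<open>\<mu>\<^bsub>UV\<^esub>\<close> is the product of a
  distribution depending on \<open>U\<close> and one depending on \<open>V\<close>, and these are realised by thresholding two
  independent uniform variables on the unit interval.\<close>

text \<open>Coding a sequence of events by base 4 digits in \<open>{0, 1}\<close> leaves no carries, so it embeds any
  countably generated probability space into the real line with Borel decoding. Together with the
  quantile transform this transports the unit square to the unit interval.\<close>

definition quaternary :: "(nat \<Rightarrow> bool) \<Rightarrow> real" where
  "quaternary x = (\<Sum>n. of_bool (x n) / 4 ^ n)"

lemma summable_quaternary: "summable (\<lambda>n. of_bool (x n) / 4 ^ n :: real)"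
  by (rule summable_comparison_test[OF _ summable_geometric[of "1/4 :: real"]])
    (auto intro!: exI[of _ 0] simp: power_divide)

text \<open>Scaling by \<open>4 ^ n\<close> turns the digits before position \<open>n\<close> into
  the even integer \<open>h\<close>, digit \<open>n\<close> into the units and the later digits into
  at most 1/3, so the parity of the floor is digit \<open>n\<close>.\<close>

lemma odd_floor_quaternary: "odd \<lfloor>4 ^ n * quaternary x\<rfloor> \<longleftrightarrow> x n"
proof -
  define t where "t = (\<Sum>j. of_bool (x (j + Suc n)) / 4 ^ (j + Suc n) :: real)"
  have st: "summable (\<lambda>j. of_bool (x (j + Suc n)) / 4 ^ (j + Suc n) :: real)"
    by (rule summable_ignore_initial_segment[OF summable_quaternary])
  have "0 \<le> t"
    unfolding t_def by (intro suminf_nonneg st) auto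
  have "t \<le> (\<Sum>j. (1/4) ^ j * (1 / 4 ^ Suc n))"
    unfolding t_def
    by (intro suminf_le st summable_mult2 summable_geometric) (auto simp: power_add power_divide)
  also have "\<dots> = 1 / (3 * 4 ^ n)"
    by (subst suminf_mult2[symmetric]) (auto simp: suminf_geometric field_simps)
  finally have t: "0 \<le> 4 ^ n * t" "4 ^ n * t < 1"
    using \<open>0 \<le> t\<close> by (auto simp: field_simps)
  define h :: int where "h = (\<Sum>i<n. of_bool (x i) * 4 ^ (n - i))"
  have "quaternary x = t + (\<Sum>i<Suc n. of_bool (x i) / 4 ^ i)"
    unfolding quaternary_def t_def by (rule suminf_split_initial_segment[OF summable_quaternary])
  moreover have "4 ^ n * (\<Sum>i<n. of_bool (x i) / 4 ^ i :: real) = of_int h"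
    by (auto simp: h_def sum_distrib_left of_bool_def simp flip: power_diff intro!: sum.cong)
  ultimately have "4 ^ n * quaternary x = 4 ^ n * t + of_int (h + of_bool (x n))"
    by (simp add: algebra_simps)
  then have "\<lfloor>4 ^ n * quaternary x\<rfloor> = h + of_bool (x n)"
    using t by (simp add: floor_eq_iff)
  moreover have "even h"
    unfolding h_def by (intro dvd_sum) auto
  ultimately show ?thesis by simp
qed

lemma measurable_quaternary:
  assumes [measurable]: "\<And>n. Measurable.pred M (E n)"
  shows "(\<lambda>\<omega>. quaternary (\<lambda>n. E n \<omega>)) \<in> borel_measurable M"
  unfolding quaternary_def of_bool_def by measurable

section \<open>The quantile transform on the unit interval\<close>

lemma space_unit_interval: "space unit_interval = {0..1}"
  unfolding unit_interval_def by (simp add: space_restrict_space)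

lemma prob_space_unit_interval: "prob_space unit_interval"
  unfolding unit_interval_def
  by (auto simp: space_restrict_space emeasure_restrict_space intro!: prob_spaceI)

text \<open>\<open>N.I\<close> is the generalised inverse of the distribution function of
  \<open>N\<close>; it carries the uniform distribution on the open interval to
  \<open>N\<close>.\<close>

lemma unit_interval_simulates:
  assumes "real_distribution N"
  obtains J where "J \<in> borel_measurable unit_interval" "distr unit_interval borel J = N"
proof -
  interpret N: cdf_distribution N
    using assms by (simp add: cdf_distribution_def)
  \<comment> \<open>The value 0 outside the open interval is arbitrary: within the closed interval
    it concerns only the endpoints, a null set.\<close>
  define J where "J \<omega> = (if \<omega> \<in> {0<..<1} then N.I \<omega> else 0)" for \<omega>
  have J: "J \<in> borel_measurable borel"
    unfolding J_def
    using N.measurable_CI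
    by (intro measurable_If_restrict_space_iff[THEN iffD2] conjI)
      (auto simp: greaterThanLessThan_def greaterThan_def lessThan_def Int_def)
  have meas: "J \<in> borel_measurable unit_interval"
    unfolding unit_interval_def using J by (intro measurable_restrict_space1) auto
  have I: "N.I \<in> borel_measurable (restrict_space lborel {0<..<1})"
    using N.measurable_CI by (simp cong: measurable_cong_sets add: sets_restrict_space)
  have "distr unit_interval borel J = distr (restrict_space lborel {0<..<1}) borel N.I"
  proof (rule measure_eqI)
    fix A assume "A \<in> sets (distr unit_interval borel J)"
    then have A: "A \<in> sets borel" by simp
    have [measurable]: "J -` A \<in> sets borel"
      using measurable_sets[OF J A] by simp
    have eq: "N.I -` A \<inter> {0<..<1} = J -` A \<inter> {0<..<1}"
      by (auto simp: J_def)
    have "emeasure (distr unit_interval borel J) A = emeasure lborel (J -` A \<inter> {0..1})"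
      using meas A by (simp add: emeasure_distr space_unit_interval)
        (simp add: unit_interval_def emeasure_restrict_space)
    also have "\<dots> = emeasure lborel (J -` A \<inter> {0<..<1})"
      using AE_lborel_singleton[of "0::real"] AE_lborel_singleton[of "1::real"]
      by (intro emeasure_eq_AE) auto
    also have "\<dots> = emeasure (distr (restrict_space lborel {0<..<1}) borel N.I) A"
      using I A by (simp add: emeasure_distr space_restrict_space emeasure_restrict_space eq)
    finally show "emeasure (distr unit_interval borel J) A
      = emeasure (distr (restrict_space lborel {0<..<1}) borel N.I) A" .
  qed simp
  then show thesis
    using that[OF meas] N.distr_I_eq_M by simp
qed

lemma emeasure_unit_interval_less:
  assumes "0 \<le> p" "p \<le> 1"
  shows "emeasure unit_interval {u \<in> {0..1}. u < p} = ennreal p"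
    and "emeasure unit_interval {u \<in> {0..1}. \<not> u < p} = ennreal (1 - p)"
proof -
  have "{u \<in> {0..1}. u < p} = {0..<p}" "{u \<in> {0..1}. \<not> u < p} = {p..1}"
    using assms by auto
  then show "emeasure unit_interval {u \<in> {0..1}. u < p} = ennreal p"
    "emeasure unit_interval {u \<in> {0..1}. \<not> u < p} = ennreal (1 - p)"
    using assms by (auto simp: unit_interval_def emeasure_restrict_space subset_eq)
qed

section \<open>Independent biased coins\<close>

lemma UNIV_coin: "UNIV = {Heads, Tails}"
  using coin.exhaust by auto

lemma sum_coin: "sum f UNIV = f Heads + f Tails"
  unfolding UNIV_coin by simp

lemma sum_pmf_coin: "pmf p Heads + pmf p Tails = 1"
  using sum_pmf_eq_1[of UNIV p] by (simp add: sum_coin)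

text \<open>The comparison is strict so that \<open>u < c\<close> is the union of the events
  \<open>u \<le> r\<close> over rational \<open>r < c\<close>; this lets countably many events
  decide every threshold.\<close>

definition threshold_coin :: "coin pmf \<Rightarrow> real \<Rightarrow> coin" where
  "threshold_coin p u = (if u < pmf p Heads then Heads else Tails)"

lemma emeasure_threshold_coin:
  "emeasure unit_interval {u \<in> {0..1}. threshold_coin p u = x} = ennreal (pmf p x)"
proof (cases x)
  case Heads
  then have "{u \<in> {0..1}. threshold_coin p u = x} = {u \<in> {0..1}. u < pmf p Heads}"
    by (auto simp: threshold_coin_def)
  then show ?thesis
    using Heads emeasure_unit_interval_less(1)[of "pmf p Heads"] by (simp add: pmf_le_1)
next
  case Tails
  then have "{u \<in> {0..1}. threshold_coin p u = x} = {u \<in> {0..1}. \<not> u < pmf p Heads}"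
    by (auto simp: threshold_coin_def)
  moreover have "pmf p Tails = 1 - pmf p Heads"
    using sum_pmf_coin[of p] by simp
  ultimately show ?thesis
    using Tails emeasure_unit_interval_less(2)[of "pmf p Heads"] by (simp add: pmf_le_1)
qed

lemma distr_threshold_coins:
  "distr (unit_interval \<Otimes>\<^sub>M unit_interval) (count_space UNIV)
     (\<lambda>(u, v). (threshold_coin p u, threshold_coin q v)) = measure_pmf (pair_pmf p q)"
proof -
  interpret U: prob_space unit_interval by (rule prob_space_unit_interval)
  interpret UU: pair_prob_space unit_interval unit_interval ..
  have [measurable]: "threshold_coin p \<in> unit_interval \<rightarrow>\<^sub>M count_space UNIV" for p
    unfolding threshold_coin_def unit_interval_def
    by (intro measurable_restrict_space1) measurable
  have m: "(\<lambda>(u, v). (threshold_coin p u, threshold_coin q v))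
    \<in> unit_interval \<Otimes>\<^sub>M unit_interval \<rightarrow>\<^sub>M count_space UNIV"
    by (simp add: pair_measure_countable[symmetric, of "UNIV::coin set" "UNIV::coin set", simplified])
  show ?thesis
  proof (rule measure_eqI_finite[of _ UNIV])
    fix z :: "coin \<times> coin"
    obtain x y where z: "z = (x, y)" by (cases z)
    have S: "{u \<in> {0..1}. threshold_coin p u = x} \<in> sets unit_interval" for p x
      using measurable_sets[of "threshold_coin p" unit_interval "count_space UNIV" "{x}"]
      by (simp add: space_unit_interval vimage_def Int_def conj_commute)
    have "(\<lambda>(u, v). (threshold_coin p u, threshold_coin q v)) -` {z} \<inter>
        space (unit_interval \<Otimes>\<^sub>M unit_interval)
      = {u \<in> {0..1}. threshold_coin p u = x} \<times> {u \<in> {0..1}. threshold_coin q u = y}"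
      by (auto simp: z space_pair_measure space_unit_interval)
    then show "emeasure (distr (unit_interval \<Otimes>\<^sub>M unit_interval) (count_space UNIV)
        (\<lambda>(u, v). (threshold_coin p u, threshold_coin q v))) {z}
      = emeasure (measure_pmf (pair_pmf p q)) {z}"
      using m S by (simp add: emeasure_distr U.emeasure_pair_measure_Times emeasure_threshold_coin[simplified]
        emeasure_pmf_single z pmf_pair ennreal_mult)
  qed auto
qed

text \<open>All coins live on one sample space, with \<open>f p\<close> independent of the choice of
  \<open>q\<close> and \<open>g q\<close> of that of \<open>p\<close>, as the maps in
  \<open>classical\<close> require. One real number codes the events from which all thresholds in
  both coordinates of the square are decided.\<close>

lemma independent_coins_on_unit_interval:
  obtains f g :: "coin pmf \<Rightarrow> real \<Rightarrow> coin"
  where "\<And>p. f p \<in> coin_variables" "\<And>q. g q \<in> coin_variables"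
    "\<And>p q. distr unit_interval (count_space UNIV) (\<lambda>\<omega>. (f p \<omega>, g q \<omega>)) = measure_pmf (pair_pmf p q)"
proof -
  let ?S = "unit_interval \<Otimes>\<^sub>M unit_interval"
  interpret U: prob_space unit_interval by (rule prob_space_unit_interval)
  interpret UU: pair_prob_space unit_interval unit_interval ..
  \<comment> \<open>These events enumerate the rational lower half-lines in both coordinates; the
    Boolean selects the coordinate.\<close>
  define E where "E n w = (case from_nat n :: rat \<times> bool of
    (r, b) \<Rightarrow> (if b then fst w else snd w) \<le> real_of_rat r)" for n and w :: "real \<times> real"
  have id: "(\<lambda>x. x) \<in> borel_measurable unit_interval"
    unfolding unit_interval_def by (intro measurable_restrict_space1) auto
  have [measurable]: "fst \<in> borel_measurable ?S" "snd \<in> borel_measurable ?S"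
    using measurable_compose[OF measurable_fst id] measurable_compose[OF measurable_snd id] by auto
  have E: "Measurable.pred ?S (E n)" for n
    unfolding E_def by (auto split: prod.split)
  define e where "e w = quaternary (\<lambda>n. E n w)" for w
  have e[measurable]: "e \<in> borel_measurable ?S"
    unfolding e_def by (rule measurable_quaternary[OF E])
  have "real_distribution (distr ?S borel e)"
    by (intro real_distribution.intro UU.prob_space_distr e real_distribution_axioms.intro) auto
  then obtain J where J[measurable]: "J \<in> borel_measurable unit_interval"
    and dJ: "distr unit_interval borel J = distr ?S borel e"
    by (rule unit_interval_simulates)
  \<comment> \<open>The decoder searches for a rational below the bias whose event, read off as a
    digit of \<open>y\<close>, has occurred.\<close>
  define h where "h b p y = (if \<exists>r. real_of_rat r < pmf p Heads \<and> odd \<lfloor>4 ^ to_nat (r, b) * y\<rfloor>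
    then Heads else Tails)" for b :: bool and p and y :: real
  have h[measurable]: "h b p \<in> borel \<rightarrow>\<^sub>M count_space UNIV" for b p
    unfolding h_def by measurable
  have he: "h b p (e w) = threshold_coin p (if b then fst w else snd w)" for b p w
  proof -
    have "(\<exists>r. real_of_rat r < c \<and> u \<le> real_of_rat r) \<longleftrightarrow> u < c" for u c
      using of_rat_dense[of u c] by (auto intro: less_imp_le)
    then show ?thesis
      by (simp add: h_def e_def odd_floor_quaternary E_def threshold_coin_def)
  qed
  show thesis
  proof
    show "(\<lambda>\<omega>. h True p (J \<omega>)) \<in> coin_variables" "(\<lambda>\<omega>. h False p (J \<omega>)) \<in> coin_variables" for p
      unfolding coin_variables_def by measurable
  next
    fix p q
    have hh: "(\<lambda>y. (h True p y, h False q y)) \<in> borel \<rightarrow>\<^sub>M count_space UNIV"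
      by (simp add: pair_measure_countable[symmetric, of "UNIV::coin set" "UNIV::coin set", simplified])
    \<comment> \<open>\<open>J\<close> and the code \<open>e\<close> have the same law, so decoding
      either gives the same joint law.\<close>
    have "distr unit_interval (count_space UNIV) (\<lambda>\<omega>. (h True p (J \<omega>), h False q (J \<omega>)))
      = distr (distr unit_interval borel J) (count_space UNIV) (\<lambda>y. (h True p y, h False q y))"
      by (subst distr_distr[OF hh J]) (simp add: comp_def)
    also have "\<dots> = distr ?S (count_space UNIV) (\<lambda>(u, v). (threshold_coin p u, threshold_coin q v))"
      unfolding dJ by (subst distr_distr[OF hh e]) (simp add: comp_def he case_prod_beta')
    finally show "distr unit_interval (count_space UNIV) (\<lambda>\<omega>. (h True p (J \<omega>), h False q (J \<omega>)))
      = measure_pmf (pair_pmf p q)"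
      by (simp add: distr_threshold_coins)
  qed
qed

section \<open>Product vectors and product distributions\<close>

lemma sum_coin_pairs:
  "sum f UNIV = f (Heads, Heads) + f (Heads, Tails) + f (Tails, Heads) + f (Tails, Tails)"
  by (simp add: UNIV_Times_UNIV[symmetric] sum.cartesian_product' sum_coin add.assoc
      del: UNIV_Times_UNIV)

lemma tensor_mult: "tensor A B ** tensor U V = tensor (A ** U) (B ** V)"
  by (simp add: tensor_def matrix_matrix_mult_def vec_eq_iff UNIV_Times_UNIV[symmetric]
      sum.cartesian_product' sum_product mult_ac del: UNIV_Times_UNIV)

lemma tensor_mat_1: "tensor (mat 1) (mat 1) = mat 1"
  by (simp add: tensor_def mat_def vec_eq_iff prod_eq_iff)

text \<open>The tensor product of the adjoints is a left inverse.\<close>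

lemma tensor_unitary_eq_0:
  assumes "unitary U" "unitary V" "tensor U V *v v = 0"
  shows "v = 0"
proof -
  have "v = tensor (adjoint_matrix U) (adjoint_matrix V) *v (tensor U V *v v)"
    using assms(1,2) by (simp add: matrix_vector_mul_assoc tensor_mult unitary_def tensor_mat_1)
  then show ?thesis using assms(3) by simp
qed

text \<open>The determinant of the 2 by 2 coefficient matrix; over a field it vanishes exactly on
  product vectors.\<close>

definition coeff_det :: "'a::comm_ring_1 ^ (coin \<times> coin) \<Rightarrow> 'a" where
  "coeff_det v = v $ (Heads, Heads) * v $ (Tails, Tails) - v $ (Heads, Tails) * v $ (Tails, Heads)"

lemma tensor_vector_coin:
  "(tensor U V *v v) $ (x, y) =
     U $ x $ Heads * V $ y $ Heads * v $ (Heads, Heads) + U $ x $ Heads * V $ y $ Tails * v $ (Heads, Tails)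
   + U $ x $ Tails * V $ y $ Heads * v $ (Tails, Heads) + U $ x $ Tails * V $ y $ Tails * v $ (Tails, Tails)"
  by (simp add: tensor_def matrix_vector_mult_def sum_coin_pairs)

text \<open>On the coefficient matrix \<open>X\<close>, \<open>tensor U V\<close> acts as
  \<open>U\<close> times \<open>X\<close> times the transpose of \<open>V\<close>, and determinants
  multiply.\<close>

lemma coeff_det_tensor_eq_0:
  assumes "coeff_det v = 0"
  shows "coeff_det (tensor U V *v v) = 0"
proof -
  have "coeff_det (tensor U V *v v) =
      (U $ Heads $ Heads * U $ Tails $ Tails - U $ Heads $ Tails * U $ Tails $ Heads)
    * (V $ Heads $ Heads * V $ Tails $ Tails - V $ Heads $ Tails * V $ Tails $ Heads) * coeff_det v"
    unfolding coeff_det_def tensor_vector_coin by algebra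
  then show ?thesis using assms by simp
qed

text \<open>A constant coordinate is independent of the other one.\<close>

lemma pair_pmf_marginals_if_supported:
  assumes "set_pmf p \<subseteq> UNIV \<times> {s} \<or> set_pmf p \<subseteq> {s} \<times> UNIV"
  shows "p = pair_pmf (map_pmf fst p) (map_pmf snd p)"
  using assms
proof
  assume *: "set_pmf p \<subseteq> UNIV \<times> {s}"
  then have "map_pmf snd p = map_pmf (\<lambda>_. s) p"
    by (intro map_pmf_cong) auto
  then have snd: "map_pmf snd p = return_pmf s"
    by simp
  have "map_pmf (\<lambda>z. (fst z, s)) p = p"
    using * by (intro pmf.map_ident_strong) auto
  then show ?thesis
    by (simp add: snd pair_return_pmf2 pmf.map_comp comp_def)
next
  assume *: "set_pmf p \<subseteq> {s} \<times> UNIV"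
  then have "map_pmf fst p = map_pmf (\<lambda>_. s) p"
    by (intro map_pmf_cong) auto
  then have fst: "map_pmf fst p = return_pmf s"
    by simp
  have "map_pmf (\<lambda>z. (s, snd z)) p = p"
    using * by (intro pmf.map_ident_strong) auto
  then show ?thesis
    by (simp add: fst pair_return_pmf1 pmf.map_comp comp_def)
qed

lemma pmf_map_fst: "pmf (map_pmf fst p) x = (\<Sum>y\<in>UNIV. pmf p (x, y))"
  and pmf_map_snd: "pmf (map_pmf snd p) y = (\<Sum>x\<in>UNIV. pmf p (x, y))"
  for p :: "('a::finite \<times> 'b::finite) pmf"
proof -
  have "fst -` {x} = range (Pair x :: 'b \<Rightarrow> 'a \<times> 'b)" "snd -` {y} = range (\<lambda>x :: 'a. (x, y))"
    by auto
  then show "pmf (map_pmf fst p) x = (\<Sum>y\<in>UNIV. pmf p (x, y))"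
    "pmf (map_pmf snd p) y = (\<Sum>x\<in>UNIV. pmf p (x, y))"
    by (simp_all add: pmf_map measure_measure_pmf_finite sum.reindex inj_on_def)
qed

text \<open>Multiply an entry by the total mass 1 and exchange the two diagonal products: the result
  is its row sum times its column sum.\<close>

lemma pair_pmf_marginals_if_det_0:
  fixes p :: "(coin \<times> coin) pmf"
  assumes "pmf p (Heads, Heads) * pmf p (Tails, Tails) = pmf p (Heads, Tails) * pmf p (Tails, Heads)"
  shows "p = pair_pmf (map_pmf fst p) (map_pmf snd p)"
proof (rule pmf_eqI)
  fix z :: "coin \<times> coin"
  obtain x y where z: "z = (x, y)" by (cases z)
  have sum: "pmf p (Heads, Heads) + pmf p (Heads, Tails) + pmf p (Tails, Heads) + pmf p (Tails, Tails) = 1"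
    using sum_pmf_eq_1[of UNIV p] by (simp add: sum_coin_pairs)
  have HH: "pmf p (Heads, Heads) = (pmf p (Heads, Heads) + pmf p (Heads, Tails))
      * (pmf p (Heads, Heads) + pmf p (Tails, Heads))"
    using assms sum by algebra
  have HT: "pmf p (Heads, Tails) = (pmf p (Heads, Heads) + pmf p (Heads, Tails))
      * (pmf p (Heads, Tails) + pmf p (Tails, Tails))"
    using assms sum by algebra
  have TH: "pmf p (Tails, Heads) = (pmf p (Tails, Heads) + pmf p (Tails, Tails))
      * (pmf p (Heads, Heads) + pmf p (Tails, Heads))"
    using assms sum by algebra
  have TT: "pmf p (Tails, Tails) = (pmf p (Tails, Heads) + pmf p (Tails, Tails))
      * (pmf p (Heads, Tails) + pmf p (Tails, Tails))"
    using assms sum by algebra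
  show "pmf p z = pmf (pair_pmf (map_pmf fst p) (map_pmf snd p)) z"
    unfolding z pmf_pair pmf_map_fst pmf_map_snd sum_coin
    by (cases x; cases y; hypsubst; rule HH HT TH TT)
qed

section \<open>From stochastic extension to no signalling\<close>

text \<open>In the game with common payoff \<open>w\<close> and signals uniform on \<open>D\<close>,
  all classical payoffs are zero. Hence so is every average of them, and the extension turns this
  into an equation for \<open>\<mu>\<close>.\<close>

lemma quantum_payoff_eq_0:
  fixes w :: "nat \<Rightarrow> nat \<Rightarrow> coin \<Rightarrow> coin \<Rightarrow> real"
  assumes ext: "\<And>G :: (nat, nat, coin, coin) private_game.
      pstrat1 G = UNIV \<Longrightarrow> pstrat2 G = UNIV \<Longrightarrow> finite_signals G \<Longrightarrow>
      stochastic_extension (associated_game (quantum_game \<mu> G)) (associated_game G)"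
    and D: "finite D" "D \<noteq> {}"
    and F: "\<And>a. F1 a \<in> qstrategies" "\<And>b. F2 b \<in> qstrategies"
    and zero: "\<And>f g. (\<Sum>(a, b)\<in>D. w a b (f a) (g b)) = 0"
  shows "(\<Sum>(a, b)\<in>D. measure_pmf.expectation (\<mu> (F1 a) (F2 b)) (\<lambda>(s, t). w a b s t)) = 0"
proof -
  define G :: "(nat, nat, coin, coin) private_game" where
    "G = \<lparr>pstrat1 = UNIV, pstrat2 = UNIV, signals1 = fst ` D, signals2 = snd ` D,
      signal_dist = pmf_of_set D, ppayoff1 = w, ppayoff2 = w\<rparr>"
  \<comment> \<open>Strategies of the associated game are extensional functions on the signal
    sets.\<close>
  define f1 where "f1 = restrict F1 (fst ` D)"
  define f2 where "f2 = restrict F2 (snd ` D)"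
  have "finite_signals G"
    using D by (force simp: finite_signals_def G_def)
  then have "stochastic_extension (associated_game (quantum_game \<mu> G)) (associated_game G)"
    by (intro ext) (simp_all add: G_def)
  moreover have "f1 \<in> strat1 (associated_game (quantum_game \<mu> G))"
    "f2 \<in> strat2 (associated_game (quantum_game \<mu> G))"
    using F by (auto simp: f1_def f2_def associated_game_def quantum_game_def G_def)
  ultimately obtain p where p: "payoff1 (associated_game (quantum_game \<mu> G)) f1 f2
      = measure_pmf.expectation p (\<lambda>(s, t). payoff1 (associated_game G) s t)"
    unfolding stochastic_extension_def by blast
  have "payoff1 (associated_game G) s t = 0" for s t
    using D zero by (simp add: associated_game_def G_def integral_pmf_of_set)
  moreover have "payoff1 (associated_game (quantum_game \<mu> G)) f1 f2 =
    (\<Sum>(a, b)\<in>D. measure_pmf.expectation (\<mu> (f1 a) (f2 b)) (\<lambda>(s, t). w a b s t)) / card D"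
    using D by (simp add: associated_game_def quantum_game_def G_def integral_pmf_of_set)
  moreover have "(\<Sum>(a, b)\<in>D. measure_pmf.expectation (\<mu> (f1 a) (f2 b)) (\<lambda>(s, t). w a b s t))
    = (\<Sum>(a, b)\<in>D. measure_pmf.expectation (\<mu> (F1 a) (F2 b)) (\<lambda>(s, t). w a b s t))"
    by (intro sum.cong) (force simp: f1_def f2_def)+
  ultimately show ?thesis
    using p D by (simp add: case_prod_beta')
qed

lemma expectation_fst:
    "measure_pmf.expectation p (\<lambda>(s, t). c * of_bool (s = x)) = c * pmf (map_pmf fst p) x"
    and expectation_snd:
    "measure_pmf.expectation p (\<lambda>(s, t). c * of_bool (t = y)) = c * pmf (map_pmf snd p) y"
  for c :: real
proof -
  have 1: "(\<lambda>(s, t). c * of_bool (s = x)) = (\<lambda>z. c * indicator (fst -` {x}) z)"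
    and 2: "(\<lambda>(s, t). c * of_bool (t = y)) = (\<lambda>z. c * indicator (snd -` {y}) z)"
    by (auto simp: fun_eq_iff indicator_def)
  show "measure_pmf.expectation p (\<lambda>(s, t). c * of_bool (s = x)) = c * pmf (map_pmf fst p) x"
    unfolding 1 pmf_map by simp
  show "measure_pmf.expectation p (\<lambda>(s, t). c * of_bool (t = y)) = c * pmf (map_pmf snd p) y"
    unfolding 2 pmf_map by simp
qed

lemma no_signalling:
  assumes ext: "\<And>G :: (nat, nat, coin, coin) private_game.
      pstrat1 G = UNIV \<Longrightarrow> pstrat2 G = UNIV \<Longrightarrow> finite_signals G \<Longrightarrow>
      stochastic_extension (associated_game (quantum_game \<mu> G)) (associated_game G)"
    and q: "U \<in> qstrategies" "U' \<in> qstrategies" "V \<in> qstrategies" "V' \<in> qstrategies"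
  shows "map_pmf fst (\<mu> U V) = map_pmf fst (\<mu> U V')"
    and "map_pmf snd (\<mu> U V) = map_pmf snd (\<mu> U' V)"
proof -
  define \<sigma> :: "nat \<Rightarrow> real" where "\<sigma> n = (if n = 0 then 1 else - 1)" for n
  show "map_pmf fst (\<mu> U V) = map_pmf fst (\<mu> U V')"
  proof (rule pmf_eqI)
    fix x
    show "pmf (map_pmf fst (\<mu> U V)) x = pmf (map_pmf fst (\<mu> U V')) x"
    proof -
      \<comment> \<open>Player 1 sees signal 0 both times, so a classical strategy plays the same
        coin twice and the two signs cancel. The quantum sum is the difference of the two
        marginals.\<close>
      have "(\<Sum>(a, b)\<in>{(0 :: nat, 0), (0, 1)}. measure_pmf.expectation (\<mu> U (if b = 0 then V else V'))
          (\<lambda>(s, t). \<sigma> b * of_bool (s = x))) = 0"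
        by (rule quantum_payoff_eq_0[OF ext, where ?F1.0 = "\<lambda>_. U"]) (use q in \<open>auto simp: \<sigma>_def\<close>)
      then show ?thesis
        unfolding expectation_fst by (simp add: \<sigma>_def)
    qed
  qed
  show "map_pmf snd (\<mu> U V) = map_pmf snd (\<mu> U' V)"
  proof (rule pmf_eqI)
    fix x
    show "pmf (map_pmf snd (\<mu> U V)) x = pmf (map_pmf snd (\<mu> U' V)) x"
    proof -
      have "(\<Sum>(a, b)\<in>{(0, 0 :: nat), (1, 0)}. measure_pmf.expectation (\<mu> (if a = 0 then U else U') V)
          (\<lambda>(s, t). \<sigma> a * of_bool (t = x))) = 0"
        by (rule quantum_payoff_eq_0[OF ext, where ?F2.0 = "\<lambda>_. V"]) (use q in \<open>auto simp: \<sigma>_def\<close>)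
      then show ?thesis
        unfolding expectation_snd by (simp add: \<sigma>_def)
    qed
  qed
qed

section \<open>From no signalling to product vectors\<close>

text \<open>The first row is the normalised conjugate of \<open>(a, b)\<close> and the second row
  annihilates \<open>(a, b)\<close>. The second row is exposed because it is later applied to
  another vector.\<close>

lemma ex_unitary_to_axis:
  fixes a b :: complex
  assumes "a \<noteq> 0 \<or> b \<noteq> 0"
  obtains U :: "complex ^ coin ^ coin" and r
  where "unitary U" "r \<noteq> 0" "U $ Heads $ Heads * a + U $ Heads $ Tails * b = r"
    "U $ Tails $ Heads = - b / r" "U $ Tails $ Tails = a / r"
proof -
  define r where "r = complex_of_real (sqrt ((cmod a)\<^sup>2 + (cmod b)\<^sup>2))"
  define U :: "complex ^ coin ^ coin" where
    "U = (\<chi> x y. case (x, y) of (Heads, Heads) \<Rightarrow> cnj a / r | (Heads, Tails) \<Rightarrow> cnj b / r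
       | (Tails, Heads) \<Rightarrow> - b / r | (Tails, Tails) \<Rightarrow> a / r)"
  have r0: "r \<noteq> 0"
    using assms by (auto simp: r_def add_nonneg_eq_0_iff)
  have "r * r = of_real ((cmod a)\<^sup>2 + (cmod b)\<^sup>2)"
    unfolding r_def of_real_mult[symmetric] by (simp add: power2_eq_square[symmetric])
  then have rr: "r * r = a * cnj a + b * cnj b"
    by (simp add: complex_norm_square[symmetric])
  have n0: "a * cnj a + b * cnj b \<noteq> 0"
    using r0 by (simp flip: rr)
  have cr: "cnj r = r"
    by (simp add: r_def)
  show thesis
  proof
    have entry: "\<And>x y. U $ x $ y = (case (x, y) of (Heads, Heads) \<Rightarrow> cnj a / r | (Heads, Tails) \<Rightarrow> cnj b / r
       | (Tails, Heads) \<Rightarrow> - b / r | (Tails, Tails) \<Rightarrow> a / r)"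
      by (simp add: U_def)
    have coin_all: "(\<forall>x. P x) \<longleftrightarrow> P Heads \<and> P Tails" for P
      using UNIV_coin by (metis UNIV_I insertE singletonD)
    show "unitary U"
      unfolding unitary_def adjoint_matrix_def matrix_matrix_mult_def mat_def vec_eq_iff coin_all
      using r0 n0 by (auto simp: sum_coin entry cr rr divide_simps add.commute mult.commute)
    show "U $ Heads $ Heads * a + U $ Heads $ Tails * b = r"
      using r0 by (simp add: entry divide_simps rr mult.commute)
  qed (use r0 in \<open>simp_all add: U_def\<close>)
qed

lemma Unitary_in_qstrategies: "unitary U \<Longrightarrow> Unitary U \<in> qstrategies"
  and Pure_in_qstrategies: "Pure s \<in> qstrategies"
  by (auto simp: qstrategies_def)

text \<open>Rotating the column \<open>s = H\<close> of the coefficients of \<open>\<xi>\<close> onto the first axis makes the outcome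
  \<open>T\<close> impossible against the pure strategy \<open>H\<close>, hence also against \<open>T\<close>: the other column lies
  on the same axis.\<close>

lemma coeff_det_eq_0_if_no_signalling:
  assumes \<mu>: "outcome_family \<xi> \<mu>"
    and ns: "\<And>U V V'. U \<in> qstrategies \<Longrightarrow> V \<in> qstrategies \<Longrightarrow> V' \<in> qstrategies \<Longrightarrow>
      map_pmf fst (\<mu> U V) = map_pmf fst (\<mu> U V')"
  shows "coeff_det \<xi> = 0"
proof (cases "\<xi> $ (Heads, Heads) = 0 \<and> \<xi> $ (Tails, Heads) = 0")
  case True
  then show ?thesis by (simp add: coeff_det_def)
next
  case False
  then obtain U :: "complex ^ coin ^ coin" and r where U: "unitary U" and r: "r \<noteq> 0"
    and UH: "U $ Heads $ Heads * \<xi> $ (Heads, Heads) + U $ Heads $ Tails * \<xi> $ (Tails, Heads) = r"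
    and UT: "U $ Tails $ Heads = - \<xi> $ (Tails, Heads) / r" "U $ Tails $ Tails = \<xi> $ (Heads, Heads) / r"
    using ex_unitary_to_axis by (metis (no_types))
  define v where "v = tensor U (mat 1) *v \<xi>"
  have v: "v $ (x, s) = U $ x $ Heads * \<xi> $ (Heads, s) + U $ x $ Tails * \<xi> $ (Tails, s)" for x s
    by (cases s) (simp_all add: v_def tensor_vector_coin mat_def)
  have out: "proportional_on (UNIV \<times> {s}) (\<mu> (Unitary U) (Pure s)) v" for s
    using \<mu> U unfolding outcome_family_def v_def
    by (metis Unitary_in_qstrategies Pure_in_qstrategies outcome_dist.simps(2))
  have marg: "pmf (map_pmf fst (\<mu> (Unitary U) (Pure s))) x = pmf (\<mu> (Unitary U) (Pure s)) (x, s)" for x s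
  proof -
    have "pmf (\<mu> (Unitary U) (Pure s)) (x, t) = 0" if "t \<noteq> s" for t
      using out[of s] that by (auto simp: proportional_on_def pmf_eq_0_set_pmf)
    then show ?thesis
      by (cases s) (simp_all add: pmf_map_fst sum_coin)
  qed
  obtain c where c: "\<And>x. (cmod (v $ (x, Heads)))\<^sup>2 = c * pmf (\<mu> (Unitary U) (Pure Heads)) (x, Heads)"
    using out[of Heads] by (auto simp: proportional_on_def)
  obtain d where d: "\<And>x. (cmod (v $ (x, Tails)))\<^sup>2 = d * pmf (\<mu> (Unitary U) (Pure Tails)) (x, Tails)"
    using out[of Tails] by (auto simp: proportional_on_def)
  \<comment> \<open>The rotated first column has the nonzero entry \<open>r\<close>, so its zero
    entry means probability zero.\<close>
  have "c \<noteq> 0"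
    using c[of Heads] UH r by (auto simp: v)
  moreover have "v $ (Tails, Heads) = 0"
    by (simp add: v UT)
  ultimately have "pmf (\<mu> (Unitary U) (Pure Heads)) (Tails, Heads) = 0"
    using c[of Tails] by simp
  then have "pmf (\<mu> (Unitary U) (Pure Tails)) (Tails, Tails) = 0"
    using ns[of "Unitary U" "Pure Heads" "Pure Tails"] U
    by (simp add: marg[symmetric] Unitary_in_qstrategies Pure_in_qstrategies)
  \<comment> \<open>This direction holds for every \<open>d\<close>, including \<open>d = 0\<close>,
    where the second column vanishes and the distribution is a free choice.\<close>
  then have "v $ (Tails, Tails) = 0"
    using d[of Tails] by simp
  \<comment> \<open>The entry just shown to vanish is \<open>coeff_det \<xi> / r\<close>.\<close>
  then show ?thesis
    using r by (simp add: v UT coeff_det_def field_simps)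
qed

section \<open>Product distributions and their classical realisation\<close>

text \<open>For two unitaries the zero determinant of the amplitudes passes to their squared moduli,
  hence to the probabilities. With a pure strategy the support alone suffices, so undetermined
  distributions are covered too.\<close>

lemma outcome_dist_product:
  assumes "\<xi> \<noteq> 0" "coeff_det \<xi> = 0" "U \<in> qstrategies" "V \<in> qstrategies" "outcome_dist \<xi> U V p"
  shows "p = pair_pmf (map_pmf fst p) (map_pmf snd p)"
proof (cases U; cases V)
  fix A B assume UV: "U = Unitary A" "V = Unitary B"
  then have unit: "unitary A" "unitary B"
    using assms by (auto simp: qstrategies_def)
  define v where "v = tensor A B *v \<xi>"
  obtain c where c: "\<And>z. (cmod (v $ z))\<^sup>2 = c * pmf p z"
    using assms(5) by (auto simp: UV proportional_on_def v_def)
  have "v \<noteq> 0"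
    using tensor_unitary_eq_0[OF unit] assms(1) by (auto simp: v_def)
  then have "c \<noteq> 0"
    using c by (auto simp: vec_eq_iff)
  have "v $ (Heads, Heads) * v $ (Tails, Tails) = v $ (Heads, Tails) * v $ (Tails, Heads)"
    using coeff_det_tensor_eq_0[OF assms(2), of A B] by (simp add: coeff_det_def v_def)
  then have "(cmod (v $ (Heads, Heads)))\<^sup>2 * (cmod (v $ (Tails, Tails)))\<^sup>2
    = (cmod (v $ (Heads, Tails)))\<^sup>2 * (cmod (v $ (Tails, Heads)))\<^sup>2"
    by (metis norm_mult power_mult_distrib)
  then show ?thesis
    using \<open>c \<noteq> 0\<close> by (intro pair_pmf_marginals_if_det_0) (simp add: c)
qed (use assms in \<open>auto simp: proportional_on_def intro: pair_pmf_marginals_if_supported\<close>)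

theorem theorem7p6:
  fixes \<xi> :: "complex ^ (coin \<times> coin)"
    and \<mu> :: "qstrategy \<Rightarrow> qstrategy \<Rightarrow> (coin \<times> coin) pmf"
  assumes "\<xi> \<noteq> 0"
    and "outcome_family \<xi> \<mu>"
    and "\<And>G :: (nat, nat, coin, coin) private_game.
           pstrat1 G = UNIV \<Longrightarrow> pstrat2 G = UNIV \<Longrightarrow> finite_signals G \<Longrightarrow>
           stochastic_extension (associated_game (quantum_game \<mu> G)) (associated_game G)"
  shows "classical \<mu>"
proof -
  \<comment> \<open>\<open>Pure Heads\<close> is an arbitrary reference opponent; by no signalling
    these are the marginals against every opponent.\<close>
  define m1 where "m1 U = map_pmf fst (\<mu> U (Pure Heads))" for U
  define m2 where "m2 V = map_pmf snd (\<mu> (Pure Heads) V)" for V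
  note ns = no_signalling[OF assms(3)]
  have det: "coeff_det \<xi> = 0"
    using assms(2) ns(1) by (rule coeff_det_eq_0_if_no_signalling)
  have product: "\<mu> U V = pair_pmf (m1 U) (m2 V)" if "U \<in> qstrategies" "V \<in> qstrategies" for U V
  proof -
    have "\<mu> U V = pair_pmf (map_pmf fst (\<mu> U V)) (map_pmf snd (\<mu> U V))"
      using assms(1,2) det that by (auto simp: outcome_family_def intro: outcome_dist_product)
    also have "\<dots> = pair_pmf (m1 U) (m2 V)"
      unfolding m1_def m2_def
      using that Pure_in_qstrategies[of Heads] by (intro arg_cong2[of _ _ _ _ pair_pmf] ns)
    finally show ?thesis .
  qed
  obtain f g where f: "\<And>p. f p \<in> coin_variables" and g: "\<And>q. g q \<in> coin_variables"
    and fg: "\<And>p q. distr unit_interval (count_space UNIV) (\<lambda>\<omega>. (f p \<omega>, g q \<omega>))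
      = measure_pmf (pair_pmf p q)"
    by (rule independent_coins_on_unit_interval) blast
  show ?thesis
    unfolding classical_def
    by (rule bexI[of _ "\<lambda>U. f (m1 U)"], rule bexI[of _ "\<lambda>V. g (m2 V)"])
      (auto simp: f g fg product)
qed

end
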